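(* Let $e$ be a closed $\lambda_D$ term such that $\vdash e : \tau\,\langle \bullet_\mu,\bullet_\sigma\rangle\,\tau\,\langle \bullet_\mu,\bullet_\sigma\rangle\,\tau$ is derivable (in the empty type environment) in the type system of $\lambda_D$. Then evaluation of $e$ terminates.
   Context: **Source language $\lambda_D$** (call-by-value, left-to-right). Values $v ::= n \mid x \mid \lambda x.e$ ($n$ a number). Terms $e ::= v \mid e_1\,e_2 \mid \mathcal{S}k.e$ (shift) $\mid \mathcal{F}k.e$ (control) $\mid \mathcal{S}_0k.e$ (shift0) $\mid \mathcal{F}_0k.e$ (control0) $\mid \langle e\rangle$ (delimiter). Types: value/term types $\tau,\alpha,\beta,\dots ::= \mathbb{N} \mid \tau_1\to\tau_2\,\langle\mu_\alpha,\sigma_\alpha\rangle\,\alpha\,\langle\mu_\beta,\sigma_\beta\rangle\,\beta$; trail types $\mu ::= \bullet_\mu \mid \tau_1\to\langle\mu,\sigma\rangle\,\tau_2$; meta continuation types $\sigma ::= \bullet_\sigma \mid ((\tau_1\to\langle\mu_1,\sigma_1\rangle\,\tau_2)\times\mu_2)::\sigma_2$. A type environment $\Gamma$ assigns value types to variables. **Auxiliary constraints.** id-cont-type (a relation on $\tau,\mu,\sigma,\tau'$): - id-cont-type$(\tau,\bullet_\mu,\bullet_\sigma,\tau')$ iff $\tau=\tau'$; - id-cont-type$(\tau,\bullet_\mu,((\tau_1\to\langle\mu_1,\sigma_1\rangle\tau_1')\times\mu_2)::\sigma_2,\tau')$ iff $\tau=\tau_1$, $\tau'=\tau_1'$, $\mu_1=\mu_2$,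 $\sigma_1=\sigma_2$; - id-cont-type$(\tau,(\tau_1\to\langle\mu_1,\sigma_1\rangle\tau_1'),\sigma_2,\tau')$ iff $\tau=\tau_1$, $\tau'=\tau_1'$, $\mu_1=\bullet_\mu$, $\sigma_1=\sigma_2$. compatible (a relation on three trail types): - compatible$(\bullet_\mu,\mu_2,\mu_3)$ iff $\mu_2=\mu_3$; - compatible$((\tau_1\to\langle\mu_1,\sigma_1\rangle\tau_1'),\bullet_\mu,\mu_3)$ iff $(\tau_1\to\langle\mu_1,\sigma_1\rangle\tau_1')=\mu_3$; - compatible of two non-empty trail types and $\bullet_\mu$ is false; - compatible$((\tau_1\to\langle\mu_1,\sigma_1\rangle\tau_1'),(\tau_2\to\langle\mu_2,\sigma_2\rangle\tau_2'),(\tau_3\to\langle\mu_3,\sigma_3\rangle\tau_3'))$ iff $\tau_1=\tau_3$, $\tau_1'=\tau_3'$, $\sigma_1=\sigma_3$ and compatible$((\tau_2\to\langle\mu_2,\sigma_2\rangle\tau_2'),\mu_3,\mu_1)$. **Typing rules of $\lambda_D$** (judgment $\Gamma\vdash e:\tau\langle\mu_\alpha,\sigma_\alpha\rangle\alpha\langle\mu_\beta,\sigma_\beta\rangle\beta$): - Var: if $x:\tau\in\Gamma$ then $\Gamma\vdash x:\tau\langle\mu_\alpha,\sigma_\alpha\rangle\alpha\langle\mu_\alpha,\sigma_\alpha\rangle\alpha$. Num: $\Gamma\vdash n:\mathbb{N}\langle\mu_\alpha,\sigma_\alpha\rangle\alpha\langle\mu_\alpha,\sigma_\alpha\rangle\alpha$.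 - Lam: if $\Gamma,x:\tau_1\vdash e:\tau_2\langle\mu_\alpha,\sigma_\alpha\rangle\alpha\langle\mu_\beta,\sigma_\beta\rangle\beta$ then $\Gamma\vdash\lambda x.e:(\tau_1\to\tau_2\langle\mu_\alpha,\sigma_\alpha\rangle\alpha\langle\mu_\beta,\sigma_\beta\rangle\beta)\langle\mu_\gamma,\sigma_\gamma\rangle\gamma\langle\mu_\gamma,\sigma_\gamma\rangle\gamma$. - App: if $\Gamma\vdash e_1:(\tau_1\to\tau_2\langle\mu_\alpha,\sigma_\alpha\rangle\alpha\langle\mu_\beta,\sigma_\beta\rangle\beta)\langle\mu_\gamma,\sigma_\gamma\rangle\gamma\langle\mu_\delta,\sigma_\delta\rangle\delta$ and $\Gamma\vdash e_2:\tau_1\langle\mu_\beta,\sigma_\beta\rangle\beta\langle\mu_\gamma,\sigma_\gamma\rangle\gamma$ then $\Gamma\vdash e_1e_2:\tau_2\langle\mu_\alpha,\sigma_\alpha\rangle\alpha\langle\mu_\delta,\sigma_\delta\rangle\delta$. - Shift: if id-cont-type$(\gamma,\mu_{id},\sigma_{id},\gamma')$ and $\Gamma,k:\tau\to\tau_1\langle\mu_1,\sigma_1\rangle\tau_2\langle\mu_2,\sigma_2\rangle\alpha\vdash e:\gamma\langle\mu_{id},\sigma_{id}\rangle\gamma'\langle\bullet_\mu,\sigma_\beta\rangle\beta$ then $\Gamma\vdash\mathcal{S}k.e:\tau\langle\mu_\beta,((\tau_1\to\langle\mu_1,\sigma_1\rangle\tau_2)\times\mu_2)::\sigma_2\rangle\alpha\langle\mu_\beta,\sigma_\beta\rangle\beta$.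 - Control: if id-cont-type$(\gamma,\mu_{id},\sigma_{id},\gamma')$, compatible$((\tau_1\to\langle\mu_1,\sigma_1\rangle\tau_2),\mu_2,\mu_\gamma)$, compatible$(\mu_\beta,\mu_\gamma,\mu_\alpha)$ and $\Gamma,k:\tau\to\tau_1\langle\mu_1,\sigma_1\rangle\tau_2\langle\mu_2,\sigma_\alpha\rangle\alpha\vdash e:\gamma\langle\mu_{id},\sigma_{id}\rangle\gamma'\langle\bullet_\mu,\sigma_\beta\rangle\beta$ then $\Gamma\vdash\mathcal{F}k.e:\tau\langle\mu_\alpha,\sigma_\alpha\rangle\alpha\langle\mu_\beta,\sigma_\beta\rangle\beta$. - Shift0: if $\Gamma,k:\tau\to\tau_1\langle\mu_1,\sigma_1\rangle\tau_2\langle\mu_2,\sigma_2\rangle\alpha\vdash e:\tau_0\langle\mu_0,\sigma_0\rangle\tau_0'\langle\mu_0',\sigma_0'\rangle\beta$ then $\Gamma\vdash\mathcal{S}_0k.e:\tau\langle\mu_\beta,((\tau_1\to\langle\mu_1,\sigma_1\rangle\tau_2)\times\mu_2)::\sigma_2\rangle\alpha\langle\mu_\beta,((\tau_0\to\langle\mu_0,\sigma_0\rangle\tau_0')\times\mu_0')::\sigma_0'\rangle\beta$. - Control0: if compatible$((\tau_1\to\langle\mu_1,\sigma_1\rangle\tau_2),\mu_2,\mu_\gamma)$, compatible$(\mu_\beta,\mu_\gamma,\mu_\alpha)$ and $\Gamma,k:\tau\to\tau_1\langle\mu_1,\sigma_1\rangle\tau_2\langle\mu_2,\sigma_\alpha\rangle\alpha\vdash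 e:\tau_0\langle\mu_0,\sigma_0\rangle\tau_0'\langle\mu_0',\sigma_0'\rangle\beta$ then $\Gamma\vdash\mathcal{F}_0k.e:\tau\langle\mu_\alpha,\sigma_\alpha\rangle\alpha\langle\mu_\beta,((\tau_0\to\langle\mu_0,\sigma_0\rangle\tau_0')\times\mu_0')::\sigma_0'\rangle\beta$. - Prompt0: if id-cont-type$(\gamma,\mu_{id},\sigma_{id},\gamma')$ and $\Gamma\vdash e:\gamma\langle\mu_{id},\sigma_{id}\rangle\gamma'\langle\bullet_\mu,((\tau\to\langle\mu_\alpha,\sigma_\alpha\rangle\alpha)\times\mu_\beta)::\sigma_\beta\rangle\beta$ then $\Gamma\vdash\langle e\rangle:\tau\langle\mu_\alpha,\sigma_\alpha\rangle\alpha\langle\mu_\beta,\sigma_\beta\rangle\beta$. **Target language $\lambda_C$**: the standard simply-typed $\lambda$-calculus with types int, unit, $\tau_1\to\tau_2$, $\tau_1\times\tau_2$, with numbers, unit value $()$, pairs (and pair patterns), and a case analysis on whether an argument is $()$ or not; in typed use such a case analysis is resolved by the (known) types of the scrutinised trail and meta continuation (type unit, i.e. $\bullet^*$, versus non-unit). **Type translation.** $\mathbb{N}^*=\mathrm{int}$; $(\tau_1\to\tau_2\langle\mu_\alpha,\sigma_\alpha\rangle\alpha\langle\mu_\beta,\sigma_\beta\rangle\beta)^*=\tau_1^*\to(\tau_2^*\to\mu_\alpha^*\to\sigma_\alpha^*\to\alpha^* )\to\mu_\beta^*\to\sigma_\beta^*\to\beta^*$; $\bullet_\mu^*=\mathrm{unit}$;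 $(\tau_1\to\langle\mu,\sigma\rangle\tau_2)^*=\tau_1^*\to\mu^*\to\sigma^*\to\tau_2^*$; $\bullet_\sigma^*=\mathrm{unit}$; $(((\tau_1\to\langle\mu_1,\sigma_1\rangle\tau_2)\times\mu_2)::\sigma_2)^*=((\tau_1^*\to\mu_1^*\to\sigma_1^*\to\tau_2^* )\times\mu_2^* )\times\sigma_2^*$. **CPS interpreter** (it defines the semantics of $\lambda_D$). It acts on typed terms (the case analyses in the auxiliary functions are selected by the types appearing in the derivation, according to id-cont-type and compatible). - $k_{id}=\lambda v.\lambda t.\lambda m.$ case $(t,m)$ of $((),())\Rightarrow v$; $((),((k_0,t_0),m_0))\Rightarrow k_0\,v\,t_0\,m_0$; otherwise ($t$ a non-empty trail) $\Rightarrow t\,v\,()\,m$. - $t_1@t_2$: $()@t_2=t_2$; $k@t_2=k::t_2$ for $k$ non-empty. - $k::t$: $k::()=k$; $k::t=\lambda v.\lambda t'.\lambda m'.\,k\,v\,(t::t')\,m'$ for $t$ non-empty. - $\mathcal{E}[\![x]\!]\rho\kappa=\lambda t.\lambda m.\kappa\,\rho(x)\,t\,m$; $\mathcal{E}[\![n]\!]\rho\kappa=\lambda t.\lambda m.\kappa\,n\,t\,m$; $\mathcal{E}[\![\lambda x.e]\!]\rho\kappa=\lambda t.\lambda m.\kappa\,(\lambda v.\mathcal{E}[\![e]\!]\rho[v/x])\,t\,m$. - $\mathcal{E}[\![e_1e_2]\!]\rho\kappa=\lambda t.\lambda m.\mathcal{E}[\![e_1]\!]\rho(\lambda v_1.\lambda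 t_1.\lambda m_1.\mathcal{E}[\![e_2]\!]\rho(\lambda v_2.\lambda t_2.\lambda m_2.v_1\,v_2\,\kappa\,t_2\,m_2)\,t_1\,m_1)\,t\,m$. - $\mathcal{E}[\![\mathcal{S}k.e]\!]\rho\kappa=\lambda t.\lambda m.\mathcal{E}[\![e]\!]\rho[(\lambda v.\lambda\kappa'.\lambda t'.\lambda m'.\kappa\,v\,t\,((\kappa',t'),m'))/k]\,k_{id}\,()\,m$. - $\mathcal{E}[\![\mathcal{F}k.e]\!]\rho\kappa=\lambda t.\lambda m.\mathcal{E}[\![e]\!]\rho[(\lambda v.\lambda\kappa'.\lambda t'.\lambda m'.\kappa\,v\,(t@(\kappa'::t'))\,m')/k]\,k_{id}\,()\,m$. - $\mathcal{E}[\![\mathcal{S}_0k.e]\!]\rho\kappa=\lambda t.\lambda((\kappa_0,t_0),m_0).\mathcal{E}[\![e]\!]\rho[(\lambda v.\lambda\kappa'.\lambda t'.\lambda m'.\kappa\,v\,t\,((\kappa',t'),m'))/k]\,\kappa_0\,t_0\,m_0$. - $\mathcal{E}[\![\mathcal{F}_0k.e]\!]\rho\kappa=\lambda t.\lambda((\kappa_0,t_0),m_0).\mathcal{E}[\![e]\!]\rho[(\lambda v.\lambda\kappa'.\lambda t'.\lambda m'.\kappa\,v\,(t@(\kappa'::t'))\,m')/k]\,\kappa_0\,t_0\,m_0$. - $\mathcal{E}[\![\langle e\rangle]\!]\rho\kappa=\lambda t.\lambda m.\mathcal{E}[\![e]\!]\rho\,k_{id}\,()\,((\kappa,t),m)$.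 **Evaluation** of a closed term $e$ of the type in the claim means running the interpreter with the empty environment and the initial continuation, trail and meta continuation, i.e. evaluating (call-by-value) the $\lambda_C$ expression $\mathcal{E}[\![e]\!]\,\emptyset\,k_{id}\,()\,()$, with $k_{id}$ taken at the types $\tau,\bullet_\mu,\bullet_\sigma,\tau$ (so $k_{id}=\lambda v.\lambda t.\lambda m.v$); it terminates if this reaches a value after finitely many steps. *)

theory Defs
  imports Main
begin

section \<open>The source language\<close>

type_synonym vname = string

datatype expr =
    Var vname
  | Num nat
  | Lam vname expr
  | App expr expr
  | Shift vname expr
  | Control vname expr
  | Shift0 vname expr
  | Control0 vname expr
  | Prompt expr

text \<open>
  Argument order follows the usual left-to-right notation:
  \<^item> \<open>TFun \<tau>\<^sub>1 \<tau>\<^sub>2 \<mu>\<^sub>\<alpha> \<sigma>\<^sub>\<alpha> \<alpha> \<mu>\<^sub>\<beta> \<sigma>\<^sub>\<beta> \<beta>\<close> is \<open>\<tau>\<^sub>1 \<rightarrow> \<tau>\<^sub>2 \<langle>\<mu>\<^sub>\<alpha>,\<sigma>\<^sub>\<alpha>\<rangle> \<alpha> \<langle>\<mu>\<^sub>\<beta>,\<sigma>\<^sub>\<beta>\<rangle> \<beta>\<close>;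
  \<^item> \<open>MFun \<tau>\<^sub>1 \<mu> \<sigma> \<tau>\<^sub>2\<close> is the trail type \<open>\<tau>\<^sub>1 \<rightarrow> \<langle>\<mu>,\<sigma>\<rangle> \<tau>\<^sub>2\<close>;
  \<^item> \<open>SCons \<tau>\<^sub>1 \<mu>\<^sub>1 \<sigma>\<^sub>1 \<tau>\<^sub>2 \<mu>\<^sub>2 \<sigma>\<^sub>2\<close> is the meta continuation type
    \<open>((\<tau>\<^sub>1 \<rightarrow> \<langle>\<mu>\<^sub>1,\<sigma>\<^sub>1\<rangle> \<tau>\<^sub>2) \<times> \<mu>\<^sub>2) :: \<sigma>\<^sub>2\<close>.
\<close>

datatype ty =
    TNat
  | TFun ty ty trail mcont ty trail mcont ty
and trail =
    MEmp  ("\<bullet>\<^sub>\<mu>")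
  | MFun ty trail mcont ty
and mcont =
    SEmp  ("\<bullet>\<^sub>\<sigma>")
  | SCons ty trail mcont ty trail mcont

fun id_cont_type :: "ty \<Rightarrow> trail \<Rightarrow> mcont \<Rightarrow> ty \<Rightarrow> bool" where
  "id_cont_type \<tau> \<bullet>\<^sub>\<mu> \<bullet>\<^sub>\<sigma> \<tau>' \<longleftrightarrow> \<tau> = \<tau>'"
| "id_cont_type \<tau> \<bullet>\<^sub>\<mu> (SCons \<tau>\<^sub>1 \<mu>\<^sub>1 \<sigma>\<^sub>1 \<tau>\<^sub>1' \<mu>\<^sub>2 \<sigma>\<^sub>2) \<tau>' \<longleftrightarrow>
     \<tau> = \<tau>\<^sub>1 \<and> \<tau>' = \<tau>\<^sub>1' \<and> \<mu>\<^sub>1 = \<mu>\<^sub>2 \<and> \<sigma>\<^sub>1 = \<sigma>\<^sub>2"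
| "id_cont_type \<tau> (MFun \<tau>\<^sub>1 \<mu>\<^sub>1 \<sigma>\<^sub>1 \<tau>\<^sub>1') \<sigma>\<^sub>2 \<tau>' \<longleftrightarrow>
     \<tau> = \<tau>\<^sub>1 \<and> \<tau>' = \<tau>\<^sub>1' \<and> \<mu>\<^sub>1 = \<bullet>\<^sub>\<mu> \<and> \<sigma>\<^sub>1 = \<sigma>\<^sub>2"

function compatible :: "trail \<Rightarrow> trail \<Rightarrow> trail \<Rightarrow> bool" where
  "compatible \<bullet>\<^sub>\<mu> \<mu>\<^sub>2 \<mu>\<^sub>3 \<longleftrightarrow> \<mu>\<^sub>2 = \<mu>\<^sub>3"
| "compatible (MFun \<tau>\<^sub>1 \<mu>\<^sub>1 \<sigma>\<^sub>1 \<tau>\<^sub>1') \<bullet>\<^sub>\<mu> \<mu>\<^sub>3 \<longleftrightarrow> MFun \<tau>\<^sub>1 \<mu>\<^sub>1 \<sigma>\<^sub>1 \<tau>\<^sub>1' = \<mu>\<^sub>3"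
| "compatible (MFun \<tau>\<^sub>1 \<mu>\<^sub>1 \<sigma>\<^sub>1 \<tau>\<^sub>1') (MFun \<tau>\<^sub>2 \<mu>\<^sub>2 \<sigma>\<^sub>2 \<tau>\<^sub>2') \<bullet>\<^sub>\<mu> \<longleftrightarrow> False"
| "compatible (MFun \<tau>\<^sub>1 \<mu>\<^sub>1 \<sigma>\<^sub>1 \<tau>\<^sub>1') (MFun \<tau>\<^sub>2 \<mu>\<^sub>2 \<sigma>\<^sub>2 \<tau>\<^sub>2') (MFun \<tau>\<^sub>3 \<mu>\<^sub>3 \<sigma>\<^sub>3 \<tau>\<^sub>3') \<longleftrightarrow>
     \<tau>\<^sub>1 = \<tau>\<^sub>3 \<and> \<tau>\<^sub>1' = \<tau>\<^sub>3' \<and> \<sigma>\<^sub>1 = \<sigma>\<^sub>3 \<and> compatible (MFun \<tau>\<^sub>2 \<mu>\<^sub>2 \<sigma>\<^sub>2 \<tau>\<^sub>2') \<mu>\<^sub>3 \<mu>\<^sub>1"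
  by pat_completeness auto
termination
  by (relation "measure (\<lambda>(\<mu>\<^sub>1, \<mu>\<^sub>2, \<mu>\<^sub>3). size \<mu>\<^sub>1 + size \<mu>\<^sub>2 + size \<mu>\<^sub>3)") auto

text \<open>
  The interpreter acts on typed terms: besides the term it reads those types of the derivation
  that select the case analyses of its auxiliary functions. A \<open>deriv\<close> is a derivation tree in
  which just these types are recorded:
  \<^item> \<open>\<mu>\<^sub>i\<^sub>d, \<sigma>\<^sub>i\<^sub>d\<close> in \<open>DShift\<close>, \<open>DControl\<close> and \<open>DPrompt\<close>;
  \<^item> \<open>\<tau>\<^sub>1 \<rightarrow> \<langle>\<mu>\<^sub>1,\<sigma>\<^sub>1\<rangle> \<tau>\<^sub>2\<close>, \<open>\<mu>\<^sub>2\<close>, \<open>\<mu>\<^sub>\<gamma>\<close>, \<open>\<mu>\<^sub>\<beta>\<close>, \<open>\<mu>\<^sub>\<alpha>\<close> (in this order) in \<open>DControl\<close> and \<open>DControl0\<close>.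
\<close>

datatype deriv =
    DVar vname
  | DNum nat
  | DLam vname deriv
  | DApp deriv deriv
  | DShift trail mcont vname deriv
  | DControl trail mcont trail trail trail trail trail vname deriv
  | DShift0 vname deriv
  | DControl0 trail trail trail trail trail vname deriv
  | DPrompt trail mcont deriv

type_synonym tyenv = "vname \<rightharpoonup> ty"

text \<open>
  \<open>\<Gamma> \<turnstile> D \<triangleright> e : \<tau> \<langle>\<mu>\<^sub>\<alpha>,\<sigma>\<^sub>\<alpha>\<rangle> \<alpha> \<langle>\<mu>\<^sub>\<beta>,\<sigma>\<^sub>\<beta>\<rangle> \<beta>\<close> says that \<open>D\<close> is a derivation of
  \<open>\<Gamma> \<turnstile> e : \<tau> \<langle>\<mu>\<^sub>\<alpha>,\<sigma>\<^sub>\<alpha>\<rangle> \<alpha> \<langle>\<mu>\<^sub>\<beta>,\<sigma>\<^sub>\<beta>\<rangle> \<beta>\<close>; omitting \<open>D\<close> gives the typing rules proper. \<open>D\<close> only records the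
  derivation and never restricts the applicability of a rule.
\<close>

inductive typing ::
  "tyenv \<Rightarrow> deriv \<Rightarrow> expr \<Rightarrow> ty \<Rightarrow> trail \<Rightarrow> mcont \<Rightarrow> ty \<Rightarrow> trail \<Rightarrow> mcont \<Rightarrow> ty \<Rightarrow> bool"
  ("_ \<turnstile> _ \<triangleright> _ : _ \<langle>_,_\<rangle> _ \<langle>_,_\<rangle> _" [51, 51, 51, 51, 51, 51, 51, 51, 51, 51] 50)
where
  T_Var:
    "\<Gamma> x = Some \<tau> \<Longrightarrow>
     \<Gamma> \<turnstile> DVar x \<triangleright> Var x : \<tau> \<langle>\<mu>\<^sub>\<alpha>,\<sigma>\<^sub>\<alpha>\<rangle> \<alpha> \<langle>\<mu>\<^sub>\<alpha>,\<sigma>\<^sub>\<alpha>\<rangle> \<alpha>"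
| T_Num:
    "\<Gamma> \<turnstile> DNum n \<triangleright> Num n : TNat \<langle>\<mu>\<^sub>\<alpha>,\<sigma>\<^sub>\<alpha>\<rangle> \<alpha> \<langle>\<mu>\<^sub>\<alpha>,\<sigma>\<^sub>\<alpha>\<rangle> \<alpha>"
| T_Lam:
    "\<Gamma>(x \<mapsto> \<tau>\<^sub>1) \<turnstile> D \<triangleright> e : \<tau>\<^sub>2 \<langle>\<mu>\<^sub>\<alpha>,\<sigma>\<^sub>\<alpha>\<rangle> \<alpha> \<langle>\<mu>\<^sub>\<beta>,\<sigma>\<^sub>\<beta>\<rangle> \<beta> \<Longrightarrow>
     \<Gamma> \<turnstile> DLam x D \<triangleright> Lam x e :
       (TFun \<tau>\<^sub>1 \<tau>\<^sub>2 \<mu>\<^sub>\<alpha> \<sigma>\<^sub>\<alpha> \<alpha> \<mu>\<^sub>\<beta> \<sigma>\<^sub>\<beta> \<beta>) \<langle>\<mu>\<^sub>\<gamma>,\<sigma>\<^sub>\<gamma>\<rangle> \<gamma> \<langle>\<mu>\<^sub>\<gamma>,\<sigma>\<^sub>\<gamma>\<rangle> \<gamma>"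
| T_App:
    "\<lbrakk>\<Gamma> \<turnstile> D\<^sub>1 \<triangleright> e\<^sub>1 : (TFun \<tau>\<^sub>1 \<tau>\<^sub>2 \<mu>\<^sub>\<alpha> \<sigma>\<^sub>\<alpha> \<alpha> \<mu>\<^sub>\<beta> \<sigma>\<^sub>\<beta> \<beta>) \<langle>\<mu>\<^sub>\<gamma>,\<sigma>\<^sub>\<gamma>\<rangle> \<gamma> \<langle>\<mu>\<^sub>\<delta>,\<sigma>\<^sub>\<delta>\<rangle> \<delta>;
      \<Gamma> \<turnstile> D\<^sub>2 \<triangleright> e\<^sub>2 : \<tau>\<^sub>1 \<langle>\<mu>\<^sub>\<beta>,\<sigma>\<^sub>\<beta>\<rangle> \<beta> \<langle>\<mu>\<^sub>\<gamma>,\<sigma>\<^sub>\<gamma>\<rangle> \<gamma>\<rbrakk> \<Longrightarrow>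
     \<Gamma> \<turnstile> DApp D\<^sub>1 D\<^sub>2 \<triangleright> App e\<^sub>1 e\<^sub>2 : \<tau>\<^sub>2 \<langle>\<mu>\<^sub>\<alpha>,\<sigma>\<^sub>\<alpha>\<rangle> \<alpha> \<langle>\<mu>\<^sub>\<delta>,\<sigma>\<^sub>\<delta>\<rangle> \<delta>"
| T_Shift:
    "\<lbrakk>id_cont_type \<gamma> \<mu>\<^sub>i\<^sub>d \<sigma>\<^sub>i\<^sub>d \<gamma>';
      \<Gamma>(k \<mapsto> TFun \<tau> \<tau>\<^sub>1 \<mu>\<^sub>1 \<sigma>\<^sub>1 \<tau>\<^sub>2 \<mu>\<^sub>2 \<sigma>\<^sub>2 \<alpha>) \<turnstile> D \<triangleright> e : \<gamma> \<langle>\<mu>\<^sub>i\<^sub>d,\<sigma>\<^sub>i\<^sub>d\<rangle> \<gamma>' \<langle>\<bullet>\<^sub>\<mu>,\<sigma>\<^sub>\<beta>\<rangle> \<beta>\<rbrakk> \<Longrightarrow>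
     \<Gamma> \<turnstile> DShift \<mu>\<^sub>i\<^sub>d \<sigma>\<^sub>i\<^sub>d k D \<triangleright> Shift k e :
       \<tau> \<langle>\<mu>\<^sub>\<beta>,SCons \<tau>\<^sub>1 \<mu>\<^sub>1 \<sigma>\<^sub>1 \<tau>\<^sub>2 \<mu>\<^sub>2 \<sigma>\<^sub>2\<rangle> \<alpha> \<langle>\<mu>\<^sub>\<beta>,\<sigma>\<^sub>\<beta>\<rangle> \<beta>"
| T_Control:
    "\<lbrakk>id_cont_type \<gamma> \<mu>\<^sub>i\<^sub>d \<sigma>\<^sub>i\<^sub>d \<gamma>';
      compatible (MFun \<tau>\<^sub>1 \<mu>\<^sub>1 \<sigma>\<^sub>1 \<tau>\<^sub>2) \<mu>\<^sub>2 \<mu>\<^sub>\<gamma>;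
      compatible \<mu>\<^sub>\<beta> \<mu>\<^sub>\<gamma> \<mu>\<^sub>\<alpha>;
      \<Gamma>(k \<mapsto> TFun \<tau> \<tau>\<^sub>1 \<mu>\<^sub>1 \<sigma>\<^sub>1 \<tau>\<^sub>2 \<mu>\<^sub>2 \<sigma>\<^sub>\<alpha> \<alpha>) \<turnstile> D \<triangleright> e : \<gamma> \<langle>\<mu>\<^sub>i\<^sub>d,\<sigma>\<^sub>i\<^sub>d\<rangle> \<gamma>' \<langle>\<bullet>\<^sub>\<mu>,\<sigma>\<^sub>\<beta>\<rangle> \<beta>\<rbrakk> \<Longrightarrow>
     \<Gamma> \<turnstile> DControl \<mu>\<^sub>i\<^sub>d \<sigma>\<^sub>i\<^sub>d (MFun \<tau>\<^sub>1 \<mu>\<^sub>1 \<sigma>\<^sub>1 \<tau>\<^sub>2) \<mu>\<^sub>2 \<mu>\<^sub>\<gamma> \<mu>\<^sub>\<beta> \<mu>\<^sub>\<alpha> k D \<triangleright> Control k e :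
       \<tau> \<langle>\<mu>\<^sub>\<alpha>,\<sigma>\<^sub>\<alpha>\<rangle> \<alpha> \<langle>\<mu>\<^sub>\<beta>,\<sigma>\<^sub>\<beta>\<rangle> \<beta>"
| T_Shift0:
    "\<Gamma>(k \<mapsto> TFun \<tau> \<tau>\<^sub>1 \<mu>\<^sub>1 \<sigma>\<^sub>1 \<tau>\<^sub>2 \<mu>\<^sub>2 \<sigma>\<^sub>2 \<alpha>) \<turnstile> D \<triangleright> e : \<tau>\<^sub>0 \<langle>\<mu>\<^sub>0,\<sigma>\<^sub>0\<rangle> \<tau>\<^sub>0' \<langle>\<mu>\<^sub>0',\<sigma>\<^sub>0'\<rangle> \<beta> \<Longrightarrow>
     \<Gamma> \<turnstile> DShift0 k D \<triangleright> Shift0 k e :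
       \<tau> \<langle>\<mu>\<^sub>\<beta>,SCons \<tau>\<^sub>1 \<mu>\<^sub>1 \<sigma>\<^sub>1 \<tau>\<^sub>2 \<mu>\<^sub>2 \<sigma>\<^sub>2\<rangle> \<alpha> \<langle>\<mu>\<^sub>\<beta>,SCons \<tau>\<^sub>0 \<mu>\<^sub>0 \<sigma>\<^sub>0 \<tau>\<^sub>0' \<mu>\<^sub>0' \<sigma>\<^sub>0'\<rangle> \<beta>"
| T_Control0:
    "\<lbrakk>compatible (MFun \<tau>\<^sub>1 \<mu>\<^sub>1 \<sigma>\<^sub>1 \<tau>\<^sub>2) \<mu>\<^sub>2 \<mu>\<^sub>\<gamma>;
      compatible \<mu>\<^sub>\<beta> \<mu>\<^sub>\<gamma> \<mu>\<^sub>\<alpha>;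
      \<Gamma>(k \<mapsto> TFun \<tau> \<tau>\<^sub>1 \<mu>\<^sub>1 \<sigma>\<^sub>1 \<tau>\<^sub>2 \<mu>\<^sub>2 \<sigma>\<^sub>\<alpha> \<alpha>) \<turnstile> D \<triangleright> e : \<tau>\<^sub>0 \<langle>\<mu>\<^sub>0,\<sigma>\<^sub>0\<rangle> \<tau>\<^sub>0' \<langle>\<mu>\<^sub>0',\<sigma>\<^sub>0'\<rangle> \<beta>\<rbrakk> \<Longrightarrow>
     \<Gamma> \<turnstile> DControl0 (MFun \<tau>\<^sub>1 \<mu>\<^sub>1 \<sigma>\<^sub>1 \<tau>\<^sub>2) \<mu>\<^sub>2 \<mu>\<^sub>\<gamma> \<mu>\<^sub>\<beta> \<mu>\<^sub>\<alpha> k D \<triangleright> Control0 k e :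
       \<tau> \<langle>\<mu>\<^sub>\<alpha>,\<sigma>\<^sub>\<alpha>\<rangle> \<alpha> \<langle>\<mu>\<^sub>\<beta>,SCons \<tau>\<^sub>0 \<mu>\<^sub>0 \<sigma>\<^sub>0 \<tau>\<^sub>0' \<mu>\<^sub>0' \<sigma>\<^sub>0'\<rangle> \<beta>"
| T_Prompt:
    "\<lbrakk>id_cont_type \<gamma> \<mu>\<^sub>i\<^sub>d \<sigma>\<^sub>i\<^sub>d \<gamma>';
      \<Gamma> \<turnstile> D \<triangleright> e : \<gamma> \<langle>\<mu>\<^sub>i\<^sub>d,\<sigma>\<^sub>i\<^sub>d\<rangle> \<gamma>' \<langle>\<bullet>\<^sub>\<mu>,SCons \<tau> \<mu>\<^sub>\<alpha> \<sigma>\<^sub>\<alpha> \<alpha> \<mu>\<^sub>\<beta> \<sigma>\<^sub>\<beta>\<rangle> \<beta>\<rbrakk> \<Longrightarrow>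
     \<Gamma> \<turnstile> DPrompt \<mu>\<^sub>i\<^sub>d \<sigma>\<^sub>i\<^sub>d D \<triangleright> Prompt e : \<tau> \<langle>\<mu>\<^sub>\<alpha>,\<sigma>\<^sub>\<alpha>\<rangle> \<alpha> \<langle>\<mu>\<^sub>\<beta>,\<sigma>\<^sub>\<beta>\<rangle> \<beta>"


section \<open>The target language\<close>

text \<open>
  Terms of the lambda calculus with numbers, unit and pairs, with de Bruijn indices. The pair
  pattern \<open>let (x, y) = M in N\<close> is \<open>CSplit M N\<close>, where \<open>N\<close> refers to \<open>x\<close> by index 1 and to \<open>y\<close> by
  index 0. No construct for the case analysis on \<open>()\<close> is needed, since it is always resolved by the
  types. Evaluation does not depend on types, so the terms carry none.
\<close>

datatype cterm =
    CVar nat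
  | CNum int
  | CUnit
  | CLam cterm
  | CApp cterm cterm  (infixl "\<cdot>" 100)
  | CPair cterm cterm
  | CSplit cterm cterm

text \<open>\<open>lift d c M\<close> increases the indices \<open>\<ge> c\<close> of \<open>M\<close> by \<open>d\<close>.\<close>

primrec lift :: "nat \<Rightarrow> nat \<Rightarrow> cterm \<Rightarrow> cterm" where
  "lift d c (CVar i) = CVar (if i < c then i else i + d)"
| "lift d c (CNum n) = CNum n"
| "lift d c CUnit = CUnit"
| "lift d c (CLam M) = CLam (lift d (Suc c) M)"
| "lift d c (M \<cdot> N) = lift d c M \<cdot> lift d c N"
| "lift d c (CPair M N) = CPair (lift d c M) (lift d c N)"
| "lift d c (CSplit M N) = CSplit (lift d c M) (lift d (c + 2) N)"

text \<open>\<open>subst j S M\<close> replaces index \<open>j\<close> in \<open>M\<close> by \<open>S\<close> and removes the binder of \<open>j\<close>.\<close>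

primrec subst :: "nat \<Rightarrow> cterm \<Rightarrow> cterm \<Rightarrow> cterm" where
  "subst j S (CVar i) = (if i < j then CVar i else if i = j then S else CVar (i - 1))"
| "subst j S (CNum n) = CNum n"
| "subst j S CUnit = CUnit"
| "subst j S (CLam M) = CLam (subst (Suc j) (lift 1 0 S) M)"
| "subst j S (M \<cdot> N) = subst j S M \<cdot> subst j S N"
| "subst j S (CPair M N) = CPair (subst j S M) (subst j S N)"
| "subst j S (CSplit M N) = CSplit (subst j S M) (subst (j + 2) (lift 2 0 S) N)"

inductive is_value :: "cterm \<Rightarrow> bool" where
  "is_value (CNum n)"
| "is_value CUnit"
| "is_value (CLam M)"
| "\<lbrakk>is_value V; is_value W\<rbrakk> \<Longrightarrow> is_value (CPair V W)"

text \<open>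
  Call-by-value, left-to-right. In the last rule \<open>W\<close> is substituted first, underneath the binder of
  the first component, whence the lifting.
\<close>

inductive step :: "cterm \<Rightarrow> cterm \<Rightarrow> bool"  (infix "\<longmapsto>" 50) where
  "M \<longmapsto> M' \<Longrightarrow> M \<cdot> N \<longmapsto> M' \<cdot> N"
| "\<lbrakk>is_value V; N \<longmapsto> N'\<rbrakk> \<Longrightarrow> V \<cdot> N \<longmapsto> V \<cdot> N'"
| "is_value V \<Longrightarrow> CLam M \<cdot> V \<longmapsto> subst 0 V M"
| "M \<longmapsto> M' \<Longrightarrow> CPair M N \<longmapsto> CPair M' N"
| "\<lbrakk>is_value V; N \<longmapsto> N'\<rbrakk> \<Longrightarrow> CPair V N \<longmapsto> CPair V N'"
| "M \<longmapsto> M' \<Longrightarrow> CSplit M N \<longmapsto> CSplit M' N"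
| "\<lbrakk>is_value V; is_value W\<rbrakk> \<Longrightarrow> CSplit (CPair V W) N \<longmapsto> subst 0 V (subst 0 (lift 1 0 W) N)"

definition terminates :: "cterm \<Rightarrow> bool" where
  "terminates M \<longleftrightarrow> (\<exists>V. is_value V \<and> step\<^sup>*\<^sup>* M V)"


section \<open>The CPS interpreter\<close>

text \<open>
  \<open>k_id \<mu> \<sigma>\<close> is the identity continuation expecting a trail of type \<open>\<mu>\<close> and a meta continuation of
  type \<open>\<sigma>\<close>.
\<close>

fun k_id :: "trail \<Rightarrow> mcont \<Rightarrow> cterm" where
  "k_id \<bullet>\<^sub>\<mu> \<bullet>\<^sub>\<sigma> = CLam (CLam (CLam (CVar 2)))"
| "k_id \<bullet>\<^sub>\<mu> (SCons \<tau>\<^sub>1 \<mu>\<^sub>1 \<sigma>\<^sub>1 \<tau>\<^sub>1' \<mu>\<^sub>2 \<sigma>\<^sub>2) =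
     \<comment> \<open>\<open>\<lambda>v. \<lambda>t. \<lambda>m. let (p, m\<^sub>0) = m in let (k\<^sub>0, t\<^sub>0) = p in k\<^sub>0 v t\<^sub>0 m\<^sub>0\<close>\<close>
     CLam (CLam (CLam (CSplit (CVar 0) (CSplit (CVar 1)
       (CVar 1 \<cdot> CVar 6 \<cdot> CVar 0 \<cdot> CVar 2)))))"
| "k_id (MFun \<tau>\<^sub>1 \<mu>\<^sub>1 \<sigma>\<^sub>1 \<tau>\<^sub>1') \<sigma> =
     \<comment> \<open>\<open>\<lambda>v. \<lambda>t. \<lambda>m. t v () m\<close>\<close>
     CLam (CLam (CLam (CVar 1 \<cdot> CVar 2 \<cdot> CUnit \<cdot> CVar 0)))"

text \<open>
  \<open>trail_cons \<mu>\<^sub>1 \<mu>\<^sub>2 \<mu>\<^sub>3\<close> and \<open>trail_append \<mu>\<^sub>1 \<mu>\<^sub>2 \<mu>\<^sub>3\<close> are the (curried) functions \<open>(::)\<close> and \<open>(@)\<close> taking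
  trails of types \<open>\<mu>\<^sub>1\<close> and \<open>\<mu>\<^sub>2\<close> to a trail of type \<open>\<mu>\<^sub>3\<close>, where \<open>compatible \<mu>\<^sub>1 \<mu>\<^sub>2 \<mu>\<^sub>3\<close>. The missing
  equations of \<open>trail_cons\<close> concern incompatible types or an empty \<open>\<mu>\<^sub>1\<close>, which do not occur in a
  derivation.
\<close>

function (sequential) trail_cons :: "trail \<Rightarrow> trail \<Rightarrow> trail \<Rightarrow> cterm" where
  "trail_cons (MFun \<tau>\<^sub>1 \<mu>\<^sub>1 \<sigma>\<^sub>1 \<tau>\<^sub>1') \<bullet>\<^sub>\<mu> \<mu>\<^sub>3 = CLam (CLam (CVar 1))"
| "trail_cons (MFun \<tau>\<^sub>1 \<mu>\<^sub>1 \<sigma>\<^sub>1 \<tau>\<^sub>1') (MFun \<tau>\<^sub>2 \<mu>\<^sub>2 \<sigma>\<^sub>2 \<tau>\<^sub>2') (MFun \<tau>\<^sub>3 \<mu>\<^sub>3 \<sigma>\<^sub>3 \<tau>\<^sub>3') =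
     \<comment> \<open>\<open>\<lambda>k. \<lambda>t. \<lambda>v. \<lambda>t'. \<lambda>m'. k v (t :: t') m'\<close>\<close>
     CLam (CLam (CLam (CLam (CLam
       (CVar 4 \<cdot> CVar 2 \<cdot>
         (trail_cons (MFun \<tau>\<^sub>2 \<mu>\<^sub>2 \<sigma>\<^sub>2 \<tau>\<^sub>2') \<mu>\<^sub>3 \<mu>\<^sub>1 \<cdot> CVar 3 \<cdot> CVar 1) \<cdot> CVar 0)))))"
  by pat_completeness auto
termination
  by (relation "measure (\<lambda>(\<mu>\<^sub>1, \<mu>\<^sub>2, \<mu>\<^sub>3). size \<mu>\<^sub>1 + size \<mu>\<^sub>2 + size \<mu>\<^sub>3)") auto

fun trail_append :: "trail \<Rightarrow> trail \<Rightarrow> trail \<Rightarrow> cterm" where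
  "trail_append \<bullet>\<^sub>\<mu> \<mu>\<^sub>2 \<mu>\<^sub>3 = CLam (CLam (CVar 0))"
| "trail_append (MFun \<tau>\<^sub>1 \<mu>\<^sub>1 \<sigma>\<^sub>1 \<tau>\<^sub>1') \<mu>\<^sub>2 \<mu>\<^sub>3 = trail_cons (MFun \<tau>\<^sub>1 \<mu>\<^sub>1 \<sigma>\<^sub>1 \<tau>\<^sub>1') \<mu>\<^sub>2 \<mu>\<^sub>3"

type_synonym cenv = "vname \<rightharpoonup> cterm"

definition lift_env :: "nat \<Rightarrow> cenv \<Rightarrow> cenv" where
  "lift_env d \<rho> = map_option (lift d 0) \<circ> \<rho>"

text \<open>
  \<open>interp D \<rho> \<kappa>\<close> is the target term \<open>\<E>\<lbrakk>e\<rbrakk> \<rho> \<kappa>\<close>, where \<open>D\<close> is a derivation for \<open>e\<close>. The entries of \<open>\<rho>\<close>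
  and the term \<open>\<kappa>\<close> live in the target context in which \<open>\<E>\<lbrakk>e\<rbrakk> \<rho> \<kappa>\<close> is placed, and are lifted whenever they
  move under binders. In the clause for \<open>\<lambda>x. e\<close> the partial application \<open>\<lambda>v. \<E>\<lbrakk>e\<rbrakk> \<rho>[v/x]\<close> is
  \<open>\<lambda>v. \<lambda>\<kappa>'. \<E>\<lbrakk>e\<rbrakk> \<rho>[v/x] \<kappa>'\<close>.
\<close>

primrec interp :: "deriv \<Rightarrow> cenv \<Rightarrow> cterm \<Rightarrow> cterm" where
  "interp (DVar x) \<rho> \<kappa> =
     CLam (CLam (lift 2 0 \<kappa> \<cdot> the (lift_env 2 \<rho> x) \<cdot> CVar 1 \<cdot> CVar 0))"
| "interp (DNum n) \<rho> \<kappa> =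
     CLam (CLam (lift 2 0 \<kappa> \<cdot> CNum (int n) \<cdot> CVar 1 \<cdot> CVar 0))"
| "interp (DLam x D) \<rho> \<kappa> =
     CLam (CLam
       (lift 2 0 \<kappa> \<cdot> CLam (CLam (interp D ((lift_env 4 \<rho>)(x \<mapsto> CVar 1)) (CVar 0)))
         \<cdot> CVar 1 \<cdot> CVar 0))"
| "interp (DApp D\<^sub>1 D\<^sub>2) \<rho> \<kappa> =
     \<comment> \<open>\<open>\<lambda>t. \<lambda>m. \<E>\<lbrakk>e\<^sub>1\<rbrakk> \<rho> (\<lambda>v\<^sub>1. \<lambda>t\<^sub>1. \<lambda>m\<^sub>1. \<E>\<lbrakk>e\<^sub>2\<rbrakk> \<rho> (\<lambda>v\<^sub>2. \<lambda>t\<^sub>2. \<lambda>m\<^sub>2. v\<^sub>1 v\<^sub>2 \<kappa> t\<^sub>2 m\<^sub>2) t\<^sub>1 m\<^sub>1) t m\<close>\<close>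
     CLam (CLam
       (interp D\<^sub>1 (lift_env 2 \<rho>)
         (CLam (CLam (CLam
           (interp D\<^sub>2 (lift_env 5 \<rho>)
             (CLam (CLam (CLam
               (CVar 5 \<cdot> CVar 2 \<cdot> lift 8 0 \<kappa> \<cdot> CVar 1 \<cdot> CVar 0))))
             \<cdot> CVar 1 \<cdot> CVar 0))))
         \<cdot> CVar 1 \<cdot> CVar 0))"
| "interp (DShift \<mu>\<^sub>i\<^sub>d \<sigma>\<^sub>i\<^sub>d k D) \<rho> \<kappa> =
     \<comment> \<open>\<open>\<lambda>t. \<lambda>m. \<E>\<lbrakk>e\<rbrakk> \<rho>[(\<lambda>v. \<lambda>\<kappa>'. \<lambda>t'. \<lambda>m'. \<kappa> v t ((\<kappa>', t'), m'))/k] k\<^sub>i\<^sub>d () m\<close>\<close>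
     CLam (CLam
       (interp D
         ((lift_env 2 \<rho>)(k \<mapsto>
           CLam (CLam (CLam (CLam
             (lift 6 0 \<kappa> \<cdot> CVar 3 \<cdot> CVar 5 \<cdot> CPair (CPair (CVar 2) (CVar 1)) (CVar 0)))))))
         (k_id \<mu>\<^sub>i\<^sub>d \<sigma>\<^sub>i\<^sub>d)
         \<cdot> CUnit \<cdot> CVar 0))"
| "interp (DControl \<mu>\<^sub>i\<^sub>d \<sigma>\<^sub>i\<^sub>d \<mu>\<^sub>\<kappa> \<mu>\<^sub>2 \<mu>\<^sub>\<gamma> \<mu>\<^sub>\<beta> \<mu>\<^sub>\<alpha> k D) \<rho> \<kappa> =
     \<comment> \<open>\<open>\<lambda>t. \<lambda>m. \<E>\<lbrakk>e\<rbrakk> \<rho>[(\<lambda>v. \<lambda>\<kappa>'. \<lambda>t'. \<lambda>m'. \<kappa> v (t @ (\<kappa>' :: t')) m')/k] k\<^sub>i\<^sub>d () m\<close>\<close>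
     CLam (CLam
       (interp D
         ((lift_env 2 \<rho>)(k \<mapsto>
           CLam (CLam (CLam (CLam
             (lift 6 0 \<kappa> \<cdot> CVar 3 \<cdot>
               (trail_append \<mu>\<^sub>\<beta> \<mu>\<^sub>\<gamma> \<mu>\<^sub>\<alpha> \<cdot> CVar 5 \<cdot>
                 (trail_cons \<mu>\<^sub>\<kappa> \<mu>\<^sub>2 \<mu>\<^sub>\<gamma> \<cdot> CVar 2 \<cdot> CVar 1)) \<cdot> CVar 0))))))
         (k_id \<mu>\<^sub>i\<^sub>d \<sigma>\<^sub>i\<^sub>d)
         \<cdot> CUnit \<cdot> CVar 0))"
| "interp (DShift0 k D) \<rho> \<kappa> =
     \<comment> \<open>\<open>\<lambda>t. \<lambda>((\<kappa>\<^sub>0, t\<^sub>0), m\<^sub>0). \<E>\<lbrakk>e\<rbrakk> \<rho>[(\<lambda>v. \<lambda>\<kappa>'. \<lambda>t'. \<lambda>m'. \<kappa> v t ((\<kappa>', t'), m'))/k] \<kappa>\<^sub>0 t\<^sub>0 m\<^sub>0\<close>\<close>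
     CLam (CLam (CSplit (CVar 0) (CSplit (CVar 1)
       (interp D
         ((lift_env 6 \<rho>)(k \<mapsto>
           CLam (CLam (CLam (CLam
             (lift 10 0 \<kappa> \<cdot> CVar 3 \<cdot> CVar 9 \<cdot> CPair (CPair (CVar 2) (CVar 1)) (CVar 0)))))))
         (CVar 1)
         \<cdot> CVar 0 \<cdot> CVar 2))))"
| "interp (DControl0 \<mu>\<^sub>\<kappa> \<mu>\<^sub>2 \<mu>\<^sub>\<gamma> \<mu>\<^sub>\<beta> \<mu>\<^sub>\<alpha> k D) \<rho> \<kappa> =
     \<comment> \<open>\<open>\<lambda>t. \<lambda>((\<kappa>\<^sub>0, t\<^sub>0), m\<^sub>0). \<E>\<lbrakk>e\<rbrakk> \<rho>[(\<lambda>v. \<lambda>\<kappa>'. \<lambda>t'. \<lambda>m'. \<kappa> v (t @ (\<kappa>' :: t')) m')/k] \<kappa>\<^sub>0 t\<^sub>0 m\<^sub>0\<close>\<close>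
     CLam (CLam (CSplit (CVar 0) (CSplit (CVar 1)
       (interp D
         ((lift_env 6 \<rho>)(k \<mapsto>
           CLam (CLam (CLam (CLam
             (lift 10 0 \<kappa> \<cdot> CVar 3 \<cdot>
               (trail_append \<mu>\<^sub>\<beta> \<mu>\<^sub>\<gamma> \<mu>\<^sub>\<alpha> \<cdot> CVar 9 \<cdot>
                 (trail_cons \<mu>\<^sub>\<kappa> \<mu>\<^sub>2 \<mu>\<^sub>\<gamma> \<cdot> CVar 2 \<cdot> CVar 1)) \<cdot> CVar 0))))))
         (CVar 1)
         \<cdot> CVar 0 \<cdot> CVar 2))))"
| "interp (DPrompt \<mu>\<^sub>i\<^sub>d \<sigma>\<^sub>i\<^sub>d D) \<rho> \<kappa> =
     \<comment> \<open>\<open>\<lambda>t. \<lambda>m. \<E>\<lbrakk>e\<rbrakk> \<rho> k\<^sub>i\<^sub>d () ((\<kappa>, t), m)\<close>\<close>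
     CLam (CLam
       (interp D (lift_env 2 \<rho>) (k_id \<mu>\<^sub>i\<^sub>d \<sigma>\<^sub>i\<^sub>d)
         \<cdot> CUnit \<cdot> CPair (CPair (lift 2 0 \<kappa>) (CVar 1)) (CVar 0)))"

end

theory Submission
  imports Defs
begin

text \<open>
  The interpreter maps derivations to simply typed target terms: a term of type
  \<open>\<tau> \<langle>\<mu>\<^sub>\<alpha>,\<sigma>\<^sub>\<alpha>\<rangle> \<alpha> \<langle>\<mu>\<^sub>\<beta>,\<sigma>\<^sub>\<beta>\<rangle> \<beta>\<close> and a continuation of type \<open>\<tau>\<^sup>* \<rightarrow> \<mu>\<^sub>\<alpha>\<^sup>* \<rightarrow> \<sigma>\<^sub>\<alpha>\<^sup>* \<rightarrow> \<alpha>\<^sup>*\<close> give a target term of type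
  \<open>\<mu>\<^sub>\<beta>\<^sup>* \<rightarrow> \<sigma>\<^sub>\<beta>\<^sup>* \<rightarrow> \<beta>\<^sup>*\<close>. Termination is therefore inherited from the simply typed lambda calculus, whose
  call-by-value normalization is shown with Tait's reducibility predicate on closed values.
\<close>

section \<open>Simple types for the target language\<close>

datatype cty =
    CInt
  | COne
  | CFun cty cty  (infixr "\<rightarrow>\<^sub>C" 60)
  | CProd cty cty  (infixr "\<times>\<^sub>C" 65)

text \<open>The most recently bound variable, which has index 0, is the head of the context.\<close>

inductive has_type :: "cty list \<Rightarrow> cterm \<Rightarrow> cty \<Rightarrow> bool" where
  HT_Var: "\<lbrakk>i < length G; G ! i = A\<rbrakk> \<Longrightarrow> has_type G (CVar i) A"
| HT_Num: "has_type G (CNum n) CInt"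
| HT_Unit: "has_type G CUnit COne"
| HT_Lam: "has_type (A # G) M B \<Longrightarrow> has_type G (CLam M) (A \<rightarrow>\<^sub>C B)"
| HT_App: "\<lbrakk>has_type G M (A \<rightarrow>\<^sub>C B); has_type G N A\<rbrakk> \<Longrightarrow> has_type G (M \<cdot> N) B"
| HT_Pair: "\<lbrakk>has_type G M A; has_type G N B\<rbrakk> \<Longrightarrow> has_type G (CPair M N) (A \<times>\<^sub>C B)"
| HT_Split: "\<lbrakk>has_type G M (A \<times>\<^sub>C B); has_type (B # A # G) N C\<rbrakk> \<Longrightarrow> has_type G (CSplit M N) C"

text \<open>The prefix \<open>G\<^sub>1\<close> collects the binders crossed by the
  induction.\<close>

lemma has_type_lift:
  assumes "has_type (G\<^sub>1 @ G\<^sub>2) M A"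
  shows "has_type (G\<^sub>1 @ G' @ G\<^sub>2) (lift (length G') (length G\<^sub>1) M) A"
  using assms
proof (induction "G\<^sub>1 @ G\<^sub>2" M A arbitrary: G\<^sub>1 rule: has_type.induct)
  case (HT_Var i A)
  then show ?case by (auto intro!: has_type.HT_Var simp: nth_append)
next
  case (HT_Lam A M B)
  then show ?case using HT_Lam(2)[of "A # G\<^sub>1"] by (auto intro: has_type.intros)
next
  case (HT_Split M A B N C)
  then show ?case using HT_Split(4)[of "B # A # G\<^sub>1"]
    by (auto intro!: has_type.HT_Split[of _ _ A B])
qed (auto intro: has_type.intros)

lemma has_type_weaken:
  "\<lbrakk>has_type G M A; length G' = d\<rbrakk> \<Longrightarrow> has_type (G' @ G) (lift d 0 M) A"
  using has_type_lift[of "[]"] by auto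

section \<open>Call-by-value normalization\<close>

primrec indices_below :: "nat \<Rightarrow> cterm \<Rightarrow> bool" where
  "indices_below n (CVar i) \<longleftrightarrow> i < n"
| "indices_below n (CNum m) \<longleftrightarrow> True"
| "indices_below n CUnit \<longleftrightarrow> True"
| "indices_below n (CLam M) \<longleftrightarrow> indices_below (Suc n) M"
| "indices_below n (M \<cdot> N) \<longleftrightarrow> indices_below n M \<and> indices_below n N"
| "indices_below n (CPair M N) \<longleftrightarrow> indices_below n M \<and> indices_below n N"
| "indices_below n (CSplit M N) \<longleftrightarrow> indices_below n M \<and> indices_below (n + 2) N"

abbreviation closed :: "cterm \<Rightarrow> bool" where
  "closed \<equiv> indices_below 0"

lemma indices_below_mono: "\<lbrakk>indices_below m M; m \<le> n\<rbrakk> \<Longrightarrow> indices_below n M"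
  by (induction M arbitrary: m n) fastforce+

lemma lift_indices_below: "\<lbrakk>indices_below n M; n \<le> c\<rbrakk> \<Longrightarrow> lift d c M = M"
  by (induction M arbitrary: n c) fastforce+

lemma subst_indices_below: "\<lbrakk>indices_below n M; n \<le> j\<rbrakk> \<Longrightarrow> subst j S M = M"
  by (induction M arbitrary: n j S) fastforce+

lemma lift_closed [simp]: "closed M \<Longrightarrow> lift d c M = M"
  by (simp add: lift_indices_below)

lemma subst_closed [simp]: "closed M \<Longrightarrow> subst j S M = M"
  by (simp add: subst_indices_below)

lemma indices_below_subst:
  "\<lbrakk>indices_below (Suc n) M; closed V; j \<le> n\<rbrakk> \<Longrightarrow> indices_below n (subst j V M)"
  by (induction M arbitrary: n j) (auto intro: indices_below_mono)

lemma has_type_indices_below: "has_type G M A \<Longrightarrow> indices_below (length G) M"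
  by (induction rule: has_type.induct) auto

text \<open>For closed \<open>U\<close> and \<open>V\<close> the substitution lemma needs no
  lifting; \<open>Suc c\<close> turns into \<open>c\<close> because substituting at \<open>j\<close>
  removes a smaller index.\<close>

lemma subst_subst_closed:
  "\<lbrakk>closed U; closed V; j \<le> c\<rbrakk> \<Longrightarrow>
    subst j V (subst (Suc c) U M) = subst c U (subst j V M)"
  by (induction M arbitrary: j c) auto

text \<open>Each substitution at \<open>c\<close> lowers the larger indices by one, so closed
  entries replace the original indices \<open>c\<close>, \<open>c + 1\<close>, and so on, in the
  order of a typing context.\<close>

primrec substs :: "nat \<Rightarrow> cterm list \<Rightarrow> cterm \<Rightarrow> cterm" where
  "substs c [] M = M"
| "substs c (V # Vs) M = substs c Vs (subst c V M)"

lemma substs_simps [simp]: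
  assumes "\<forall>V\<in>set Vs. closed V"
  shows "substs c Vs (CNum n) = CNum n"
    and "substs c Vs CUnit = CUnit"
    and "substs c Vs (CLam M) = CLam (substs (Suc c) Vs M)"
    and "substs c Vs (M \<cdot> N) = substs c Vs M \<cdot> substs c Vs N"
    and "substs c Vs (CPair M N) = CPair (substs c Vs M) (substs c Vs N)"
    and "substs c Vs (CSplit M N) = CSplit (substs c Vs M) (substs (c + 2) Vs N)"
  using assms by (induction Vs arbitrary: M N) auto

lemma substs_closed: "closed M \<Longrightarrow> substs c Vs M = M"
  by (induction Vs) auto

lemma substs_Var:
  "\<lbrakk>\<forall>V\<in>set Vs. closed V; i < length Vs\<rbrakk> \<Longrightarrow> substs 0 Vs (CVar i) = Vs ! i"
  by (induction Vs arbitrary: i) (auto simp: nth_Cons substs_closed split: nat.splits)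

text \<open>For \<open>c = 0\<close> the right side is \<open>substs 0 (U # Vs) M\<close>, the form
  to which an induction hypothesis applies after a beta step.\<close>

lemma subst_substs:
  "\<lbrakk>\<forall>V\<in>set Vs. closed V; closed U\<rbrakk> \<Longrightarrow>
    subst 0 U (substs (Suc c) Vs M) = substs c Vs (subst 0 U M)"
  by (induction Vs arbitrary: M) (auto simp: subst_subst_closed)

lemma indices_below_substs:
  "\<lbrakk>\<forall>V\<in>set Vs. closed V; indices_below (length Vs) M\<rbrakk> \<Longrightarrow> closed (substs 0 Vs M)"
  by (induction Vs arbitrary: M) (auto simp: indices_below_subst)

section \<open>Reducibility and its fundamental lemma\<close>

text \<open>Only values are classified; a term is handled through a value it reduces to. At types
  other than functions, closedness follows from the shape.\<close>

primrec reducible :: "cty \<Rightarrow> cterm \<Rightarrow> bool" where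
  "reducible CInt V \<longleftrightarrow> (\<exists>n. V = CNum n)"
| "reducible COne V \<longleftrightarrow> V = CUnit"
| "reducible (A \<rightarrow>\<^sub>C B) V \<longleftrightarrow>
     closed V \<and>
     (\<exists>M. V = CLam M \<and> (\<forall>W. reducible A W \<longrightarrow> (\<exists>U. reducible B U \<and> step\<^sup>*\<^sup>* (subst 0 W M) U)))"
| "reducible (A \<times>\<^sub>C B) V \<longleftrightarrow> (\<exists>W U. V = CPair W U \<and> reducible A W \<and> reducible B U)"

lemma reducible_is_value: "reducible A V \<Longrightarrow> is_value V"
  by (induction A arbitrary: V) (auto intro: is_value.intros)

lemma reducible_closed: "reducible A V \<Longrightarrow> closed V"
  by (induction A arbitrary: V) auto

lemma list_all2_reducible_closed: "list_all2 reducible G Vs \<Longrightarrow> \<forall>V\<in>set Vs. closed V"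
  by (induction rule: list_all2_induct) (auto intro: reducible_closed)

lemma steps_context:
  assumes "\<And>M M'. M \<longmapsto> M' \<Longrightarrow> F M \<longmapsto> F M'" and "step\<^sup>*\<^sup>* M M'"
  shows "step\<^sup>*\<^sup>* (F M) (F M')"
  using assms(2) by induction (auto intro: assms(1) rtranclp.rtrancl_into_rtrancl)

lemma steps_App:
  assumes "step\<^sup>*\<^sup>* M V" "is_value V" "step\<^sup>*\<^sup>* N W"
  shows "step\<^sup>*\<^sup>* (M \<cdot> N) (V \<cdot> W)"
proof (rule rtranclp_trans)
  show "step\<^sup>*\<^sup>* (M \<cdot> N) (V \<cdot> N)"
    using steps_context[of "\<lambda>M. M \<cdot> N"] assms(1) by (auto intro: step.intros)
  show "step\<^sup>*\<^sup>* (V \<cdot> N) (V \<cdot> W)"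
    using steps_context[of "\<lambda>N. V \<cdot> N"] assms(2,3) by (auto intro: step.intros)
qed

lemma steps_Pair:
  assumes "step\<^sup>*\<^sup>* M V" "is_value V" "step\<^sup>*\<^sup>* N W"
  shows "step\<^sup>*\<^sup>* (CPair M N) (CPair V W)"
proof (rule rtranclp_trans)
  show "step\<^sup>*\<^sup>* (CPair M N) (CPair V N)"
    using steps_context[of "\<lambda>M. CPair M N"] assms(1) by (auto intro: step.intros)
  show "step\<^sup>*\<^sup>* (CPair V N) (CPair V W)"
    using steps_context[of "\<lambda>N. CPair V N"] assms(2,3) by (auto intro: step.intros)
qed

lemma steps_Split: "step\<^sup>*\<^sup>* M M' \<Longrightarrow> step\<^sup>*\<^sup>* (CSplit M N) (CSplit M' N)"
  using steps_context[of "\<lambda>M. CSplit M N"] by (auto intro: step.intros)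

text \<open>Closing substitutions make the induction go through, because the bodies of lambdas and
  splits are open.\<close>

lemma has_type_reducible:
  assumes "has_type G M A" and "list_all2 reducible G Vs"
  shows "\<exists>W. reducible A W \<and> step\<^sup>*\<^sup>* (substs 0 Vs M) W"
  using assms
proof (induction arbitrary: Vs rule: has_type.induct)
  case (HT_Var i G A)
  then show ?case
    by (auto simp: list_all2_conv_all_nth substs_Var list_all2_reducible_closed)
next
  case (HT_Num G n)
  then show ?case by (auto simp: list_all2_reducible_closed)
next
  case (HT_Unit G)
  then show ?case by (auto simp: list_all2_reducible_closed)
next
  case (HT_Lam A G M B)
  note cl = list_all2_reducible_closed[OF HT_Lam.prems]
  \<comment> \<open>Reducibility at a function type includes closedness, which comes from typing:
    the free indices lie below \<open>length G = length Vs\<close>.\<close>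
  have "has_type G (CLam M) (A \<rightarrow>\<^sub>C B)"
    using HT_Lam.hyps by (rule has_type.HT_Lam)
  then have "indices_below (length Vs) (CLam M)"
    using has_type_indices_below list_all2_lengthD[OF HT_Lam.prems] by fastforce
  then have "closed (CLam (substs (Suc 0) Vs M))"
    using cl indices_below_substs by fastforce
  moreover have "\<exists>U. reducible B U \<and> step\<^sup>*\<^sup>* (subst 0 W (substs (Suc 0) Vs M)) U"
    if "reducible A W" for W
    using HT_Lam.IH[of "W # Vs"] HT_Lam.prems that cl by (simp add: subst_substs reducible_closed)
  ultimately have "reducible (A \<rightarrow>\<^sub>C B) (CLam (substs (Suc 0) Vs M))"
    by simp
  then show ?case using cl by (metis rtranclp.rtrancl_refl substs_simps(3))
next
  case (HT_App G M A B N)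
  note cl = list_all2_reducible_closed[OF HT_App.prems]
  obtain V where V: "reducible (A \<rightarrow>\<^sub>C B) V" "step\<^sup>*\<^sup>* (substs 0 Vs M) V"
    using HT_App by blast
  obtain W where W: "reducible A W" "step\<^sup>*\<^sup>* (substs 0 Vs N) W"
    using HT_App by blast
  obtain L U where L: "V = CLam L" and U: "reducible B U" "step\<^sup>*\<^sup>* (subst 0 W L) U"
    using V(1) W(1) by auto
  have "step\<^sup>*\<^sup>* (substs 0 Vs (M \<cdot> N)) (V \<cdot> W)"
    using V(2) W(2) reducible_is_value[OF V(1)] cl by (simp add: steps_App)
  also have "V \<cdot> W \<longmapsto> subst 0 W L"
    using W(1) L by (auto intro: step.intros reducible_is_value)
  also note U(2)
  finally show ?case using U(1) by blast
next
  case (HT_Pair G M A N B)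
  note cl = list_all2_reducible_closed[OF HT_Pair.prems]
  obtain V where V: "reducible A V" "step\<^sup>*\<^sup>* (substs 0 Vs M) V"
    using HT_Pair by blast
  obtain W where W: "reducible B W" "step\<^sup>*\<^sup>* (substs 0 Vs N) W"
    using HT_Pair by blast
  have "step\<^sup>*\<^sup>* (substs 0 Vs (CPair M N)) (CPair V W)"
    using V W cl by (simp add: steps_Pair reducible_is_value)
  then show ?case using V(1) W(1) by auto
next
  case (HT_Split G M A B N C)
  note cl = list_all2_reducible_closed[OF HT_Split.prems]
  obtain V W where VW: "reducible A V" "reducible B W" "step\<^sup>*\<^sup>* (substs 0 Vs M) (CPair V W)"
    using HT_Split.IH(1) HT_Split.prems by fastforce
  obtain U where U: "reducible C U" "step\<^sup>*\<^sup>* (substs 0 (W # V # Vs) N) U"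
    using HT_Split.IH(2)[of "W # V # Vs"] HT_Split.prems VW by auto
  have "step\<^sup>*\<^sup>* (substs 0 Vs (CSplit M N)) (CSplit (CPair V W) (substs 2 Vs N))"
    using VW(3) cl by (simp add: steps_Split numeral_2_eq_2)
  also have "CSplit (CPair V W) (substs 2 Vs N)
      \<longmapsto> subst 0 V (subst 0 (lift 1 0 W) (substs 2 Vs N))"
    using VW(1,2) by (intro step.intros reducible_is_value)
  \<comment> \<open>The lifting vanishes as \<open>W\<close> is closed; moved past
    \<open>Vs\<close>, the substitutions put \<open>W\<close> at index 0 and \<open>V\<close> at
    index 1, as in \<open>B # A # G\<close>.\<close>
  also have "subst 0 V (subst 0 (lift 1 0 W) (substs 2 Vs N)) = substs 0 (W # V # Vs) N"
    using VW cl by (simp add: reducible_closed subst_substs numeral_2_eq_2)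
  also note U(2)
  finally show ?case using U(1) by blast
qed

corollary has_type_terminates: "has_type [] M A \<Longrightarrow> terminates M"
  using has_type_reducible[of "[]" M A "[]"]
  by (auto simp: terminates_def intro: reducible_is_value)

section \<open>Typing of the interpreter\<close>

text \<open>A nonempty trail type is translated like a continuation type, so a continuation can
  itself serve as a trail.\<close>

primrec ty_trans :: "ty \<Rightarrow> cty"
  and trail_trans :: "trail \<Rightarrow> cty"
  and mcont_trans :: "mcont \<Rightarrow> cty" where
  "ty_trans TNat = CInt"
| "ty_trans (TFun \<tau>\<^sub>1 \<tau>\<^sub>2 \<mu>\<^sub>\<alpha> \<sigma>\<^sub>\<alpha> \<alpha> \<mu>\<^sub>\<beta> \<sigma>\<^sub>\<beta> \<beta>) =
     ty_trans \<tau>\<^sub>1 \<rightarrow>\<^sub>C (ty_trans \<tau>\<^sub>2 \<rightarrow>\<^sub>C trail_trans \<mu>\<^sub>\<alpha> \<rightarrow>\<^sub>C mcont_trans \<sigma>\<^sub>\<alpha> \<rightarrow>\<^sub>C ty_trans \<alpha>)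
       \<rightarrow>\<^sub>C trail_trans \<mu>\<^sub>\<beta> \<rightarrow>\<^sub>C mcont_trans \<sigma>\<^sub>\<beta> \<rightarrow>\<^sub>C ty_trans \<beta>"
| "trail_trans \<bullet>\<^sub>\<mu> = COne"
| "trail_trans (MFun \<tau>\<^sub>1 \<mu> \<sigma> \<tau>\<^sub>2) =
     ty_trans \<tau>\<^sub>1 \<rightarrow>\<^sub>C trail_trans \<mu> \<rightarrow>\<^sub>C mcont_trans \<sigma> \<rightarrow>\<^sub>C ty_trans \<tau>\<^sub>2"
| "mcont_trans \<bullet>\<^sub>\<sigma> = COne"
| "mcont_trans (SCons \<tau>\<^sub>1 \<mu>\<^sub>1 \<sigma>\<^sub>1 \<tau>\<^sub>2 \<mu>\<^sub>2 \<sigma>\<^sub>2) =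
     ((ty_trans \<tau>\<^sub>1 \<rightarrow>\<^sub>C trail_trans \<mu>\<^sub>1 \<rightarrow>\<^sub>C mcont_trans \<sigma>\<^sub>1 \<rightarrow>\<^sub>C ty_trans \<tau>\<^sub>2) \<times>\<^sub>C trail_trans \<mu>\<^sub>2)
       \<times>\<^sub>C mcont_trans \<sigma>\<^sub>2"

abbreviation cont_trans :: "ty \<Rightarrow> trail \<Rightarrow> mcont \<Rightarrow> ty \<Rightarrow> cty" where
  "cont_trans \<tau> \<mu> \<sigma> \<alpha> \<equiv>
     ty_trans \<tau> \<rightarrow>\<^sub>C trail_trans \<mu> \<rightarrow>\<^sub>C mcont_trans \<sigma> \<rightarrow>\<^sub>C ty_trans \<alpha>"

text \<open>Instances of the variable rule for which the type of a variable is found by unification alone.\<close>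

lemma has_type_Var_Cons:
  "has_type (A0 # G) (CVar 0) A0"
  "has_type (A0 # A1 # G) (CVar 1) A1"
  "has_type (A0 # A1 # G) (CVar (Suc 0)) A1"
  "has_type (A0 # A1 # A2 # G) (CVar 2) A2"
  "has_type (A0 # A1 # A2 # A3 # G) (CVar 3) A3"
  "has_type (A0 # A1 # A2 # A3 # A4 # G) (CVar 4) A4"
  "has_type (A0 # A1 # A2 # A3 # A4 # A5 # G) (CVar 5) A5"
  "has_type (A0 # A1 # A2 # A3 # A4 # A5 # A6 # G) (CVar 6) A6"
  "has_type (A0 # A1 # A2 # A3 # A4 # A5 # A6 # A7 # A8 # A9 # G) (CVar 9) A9"
  by (auto intro: has_type.intros)

lemmas has_type_rules = has_type_Var_Cons HT_Num HT_Unit HT_Lam HT_App HT_Pair HT_Split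

text \<open>Each clause of \<open>id_cont_type\<close> provides the type equations that make the
  matching \<open>k_id\<close> body well typed.\<close>

lemma has_type_k_id:
  "id_cont_type \<gamma> \<mu> \<sigma> \<gamma>' \<Longrightarrow> has_type G (k_id \<mu> \<sigma>) (cont_trans \<gamma> \<mu> \<sigma> \<gamma>')"
  by (cases "(\<gamma>, \<mu>, \<sigma>, \<gamma>')" rule: id_cont_type.cases; simp; (rule has_type_rules)+)

text \<open>\<open>compatible\<close> and \<open>trail_cons\<close> recurse on the same arguments,
  so induction along \<open>compatible\<close> types the inner cons.\<close>

lemma has_type_trail_cons:
  "\<lbrakk>compatible \<mu>\<^sub>1 \<mu>\<^sub>2 \<mu>\<^sub>3; \<mu>\<^sub>1 \<noteq> \<bullet>\<^sub>\<mu>\<rbrakk> \<Longrightarrow>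
    has_type G (trail_cons \<mu>\<^sub>1 \<mu>\<^sub>2 \<mu>\<^sub>3)
      (trail_trans \<mu>\<^sub>1 \<rightarrow>\<^sub>C trail_trans \<mu>\<^sub>2 \<rightarrow>\<^sub>C trail_trans \<mu>\<^sub>3)"
proof (induction \<mu>\<^sub>1 \<mu>\<^sub>2 \<mu>\<^sub>3 arbitrary: G rule: compatible.induct)
  case (2 \<tau>\<^sub>1 \<mu>\<^sub>1 \<sigma>\<^sub>1 \<tau>\<^sub>1' \<mu>\<^sub>3)
  then show ?case by (auto intro!: has_type_rules)
next
  case (4 \<tau>\<^sub>1 \<mu>\<^sub>1 \<sigma>\<^sub>1 \<tau>\<^sub>1' \<tau>\<^sub>2 \<mu>\<^sub>2 \<sigma>\<^sub>2 \<tau>\<^sub>2' \<tau>\<^sub>3 \<mu>\<^sub>3 \<sigma>\<^sub>3 \<tau>\<^sub>3')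
  \<comment> \<open>The context is arbitrary because the inner cons sits under five binders; its
    result type \<open>\<mu>\<^sub>1\<close> is the trail type that the head continuation
    expects.\<close>
  then have "has_type G (trail_cons (MFun \<tau>\<^sub>2 \<mu>\<^sub>2 \<sigma>\<^sub>2 \<tau>\<^sub>2') \<mu>\<^sub>3 \<mu>\<^sub>1)
      (cont_trans \<tau>\<^sub>2 \<mu>\<^sub>2 \<sigma>\<^sub>2 \<tau>\<^sub>2' \<rightarrow>\<^sub>C trail_trans \<mu>\<^sub>3 \<rightarrow>\<^sub>C trail_trans \<mu>\<^sub>1)" for G
    by simp
  with 4(2) show ?case by simp (rule has_type_rules | assumption)+
qed auto

lemma has_type_trail_append:
  "compatible \<mu>\<^sub>1 \<mu>\<^sub>2 \<mu>\<^sub>3 \<Longrightarrow>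
    has_type G (trail_append \<mu>\<^sub>1 \<mu>\<^sub>2 \<mu>\<^sub>3)
      (trail_trans \<mu>\<^sub>1 \<rightarrow>\<^sub>C trail_trans \<mu>\<^sub>2 \<rightarrow>\<^sub>C trail_trans \<mu>\<^sub>3)"
  by (cases \<mu>\<^sub>1) (auto intro!: has_type_rules dest: has_type_trail_cons)

section \<open>Environments and the typing of interpreted derivations\<close>

text \<open>Entries are open in \<open>G\<close>: they may be bound variables or captured
  continuations mentioning the current trail.\<close>

definition env_typed :: "tyenv \<Rightarrow> cenv \<Rightarrow> cty list \<Rightarrow> bool" where
  "env_typed \<Gamma> \<rho> G \<longleftrightarrow>
     (\<forall>x \<tau>. \<Gamma> x = Some \<tau> \<longrightarrow> (\<exists>M. \<rho> x = Some M \<and> has_type G M (ty_trans \<tau>)))"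

lemma env_typed_lift:
  "\<lbrakk>env_typed \<Gamma> \<rho> G; length G' = d\<rbrakk> \<Longrightarrow> env_typed \<Gamma> (lift_env d \<rho>) (G' @ G)"
  by (fastforce simp: env_typed_def lift_env_def intro: has_type_weaken)

lemma env_typed_update:
  "\<lbrakk>env_typed \<Gamma> \<rho> G; has_type G M (ty_trans \<tau>)\<rbrakk> \<Longrightarrow> env_typed (\<Gamma>(x \<mapsto> \<tau>)) (\<rho>(x \<mapsto> M)) G"
  by (auto simp: env_typed_def)

text \<open>The amounts count binders in \<open>interp\<close>: 2 for \<open>t\<close> and
  \<open>m\<close>, 4 more in a captured continuation, another 4 if two splits intervene, and 8
  inside an application.\<close>

lemma has_type_weaken_Cons:
  assumes "has_type G M A"
  shows "has_type (A0 # A1 # G) (lift 2 0 M) A"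
    and "has_type (A0 # A1 # A2 # A3 # A4 # A5 # G) (lift 6 0 M) A"
    and "has_type (A0 # A1 # A2 # A3 # A4 # A5 # A6 # A7 # G) (lift 8 0 M) A"
    and "has_type (A0 # A1 # A2 # A3 # A4 # A5 # A6 # A7 # A8 # A9 # G) (lift 10 0 M) A"
  using has_type_weaken[OF assms, of "[A0, A1]" 2]
    has_type_weaken[OF assms, of "[A0, A1, A2, A3, A4, A5]" 6]
    has_type_weaken[OF assms, of "[A0, A1, A2, A3, A4, A5, A6, A7]" 8]
    has_type_weaken[OF assms, of "[A0, A1, A2, A3, A4, A5, A6, A7, A8, A9]" 10]
  by simp_all

lemma env_typed_lift_Cons:
  assumes "env_typed \<Gamma> \<rho> G"
  shows "env_typed \<Gamma> (lift_env 2 \<rho>) (A0 # A1 # G)"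
    and "env_typed \<Gamma> (lift_env 4 \<rho>) (A0 # A1 # A2 # A3 # G)"
    and "env_typed \<Gamma> (lift_env 5 \<rho>) (A0 # A1 # A2 # A3 # A4 # G)"
    and "env_typed \<Gamma> (lift_env 6 \<rho>) (A0 # A1 # A2 # A3 # A4 # A5 # G)"
  using env_typed_lift[OF assms, of "[A0, A1]" 2]
    env_typed_lift[OF assms, of "[A0, A1, A2, A3]" 4]
    env_typed_lift[OF assms, of "[A0, A1, A2, A3, A4]" 5]
    env_typed_lift[OF assms, of "[A0, A1, A2, A3, A4, A5]" 6]
  by simp_all

lemmas typing_rules = has_type_weaken_Cons has_type_rules env_typed_update env_typed_lift_Cons

text \<open>Each clause of \<open>interp\<close> is typed by syntax-directed rules, with
  intermediate types found by unification.\<close>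

theorem has_type_interp:
  assumes "\<Gamma> \<turnstile> D \<triangleright> e : \<tau> \<langle>\<mu>\<^sub>\<alpha>,\<sigma>\<^sub>\<alpha>\<rangle> \<alpha> \<langle>\<mu>\<^sub>\<beta>,\<sigma>\<^sub>\<beta>\<rangle> \<beta>"
    and "env_typed \<Gamma> \<rho> G"
    and "has_type G \<kappa> (cont_trans \<tau> \<mu>\<^sub>\<alpha> \<sigma>\<^sub>\<alpha> \<alpha>)"
  shows "has_type G (interp D \<rho> \<kappa>) (trail_trans \<mu>\<^sub>\<beta> \<rightarrow>\<^sub>C mcont_trans \<sigma>\<^sub>\<beta> \<rightarrow>\<^sub>C ty_trans \<beta>)"
  using assms
proof (induction arbitrary: \<rho> G \<kappa> rule: typing.induct)
  case (T_Var \<Gamma> x \<tau> \<mu>\<^sub>\<alpha> \<sigma>\<^sub>\<alpha> \<alpha>)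
  \<comment> \<open>No typing rule matches \<open>the\<close>, so this operand is typed beforehand;
    \<open>A\<close> and \<open>B\<close> are the types of \<open>m\<close> and
    \<open>t\<close>.\<close>
  have "has_type (A # B # G) (the (lift_env 2 \<rho> x)) (ty_trans \<tau>)" for A B
    using env_typed_lift_Cons(1)[OF T_Var.prems(1), where ?A0.0 = A and ?A1.0 = B] T_Var.hyps
    unfolding env_typed_def by fastforce
  with T_Var.prems show ?case unfolding interp.simps by - (rule typing_rules | assumption)+
next
  case (T_Num \<Gamma> n \<mu>\<^sub>\<alpha> \<sigma>\<^sub>\<alpha> \<alpha>)
  then show ?case unfolding interp.simps ty_trans.simps by - (rule typing_rules | assumption)+
next
  case (T_Lam \<Gamma> x \<tau>\<^sub>1 D e \<tau>\<^sub>2 \<mu>\<^sub>\<alpha> \<sigma>\<^sub>\<alpha> \<alpha> \<mu>\<^sub>\<beta> \<sigma>\<^sub>\<beta> \<beta> \<mu>\<^sub>\<gamma> \<sigma>\<^sub>\<gamma> \<gamma>)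
  then show ?case unfolding interp.simps ty_trans.simps
    by - (rule typing_rules T_Lam.IH | assumption)+
next
  case (T_App \<Gamma> D\<^sub>1 e\<^sub>1 \<tau>\<^sub>1 \<tau>\<^sub>2 \<mu>\<^sub>\<alpha> \<sigma>\<^sub>\<alpha> \<alpha> \<mu>\<^sub>\<beta> \<sigma>\<^sub>\<beta> \<beta> \<mu>\<^sub>\<gamma> \<sigma>\<^sub>\<gamma> \<gamma> \<mu>\<^sub>\<delta> \<sigma>\<^sub>\<delta> \<delta> D\<^sub>2 e\<^sub>2)
  \<comment> \<open>Unfolding exposes the function type of \<open>v\<^sub>1\<close>, which is
    applied to four arguments.\<close>
  note IH = T_App.IH(1)[unfolded ty_trans.simps] T_App.IH(2)
  show ?case unfolding interp.simps
    by (rule typing_rules IH T_App.prems)+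
next
  case (T_Shift \<gamma> \<mu>\<^sub>i\<^sub>d \<sigma>\<^sub>i\<^sub>d \<gamma>' \<Gamma> k \<tau> \<tau>\<^sub>1 \<mu>\<^sub>1 \<sigma>\<^sub>1 \<tau>\<^sub>2 \<mu>\<^sub>2 \<sigma>\<^sub>2 \<alpha> D e \<sigma>\<^sub>\<beta> \<beta> \<mu>\<^sub>\<beta>)
  \<comment> \<open>The empty trail becomes \<open>COne\<close>, the type of \<open>CUnit\<close>,
    and the meta continuation type becomes the product matching the nested pair.\<close>
  note IH = T_Shift.IH[unfolded trail_trans.simps]
  note prems = T_Shift.prems[unfolded mcont_trans.simps]
  \<comment> \<open>The entry for \<open>k\<close> gives a goal at \<open>ty_trans\<close> of a
    function type; one unfolding yields the arrow that \<open>HT_Lam\<close> needs.\<close>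
  show ?case unfolding interp.simps
    by (rule typing_rules IH prems has_type_k_id[OF T_Shift.hyps(1)]
        | (subst ty_trans.simps; rule HT_Lam))+
next
  case (T_Control \<gamma> \<mu>\<^sub>i\<^sub>d \<sigma>\<^sub>i\<^sub>d \<gamma>' \<tau>\<^sub>1 \<mu>\<^sub>1 \<sigma>\<^sub>1 \<tau>\<^sub>2 \<mu>\<^sub>2 \<mu>\<^sub>\<gamma> \<mu>\<^sub>\<beta> \<mu>\<^sub>\<alpha> \<Gamma> k \<tau> \<sigma>\<^sub>\<alpha> \<alpha> D e \<sigma>\<^sub>\<beta> \<beta>)
  note IH = T_Control.IH[unfolded trail_trans.simps]
  \<comment> \<open>The cons of \<open>\<kappa>'\<close> and \<open>t'\<close> has type
    \<open>\<mu>\<^sub>\<gamma>\<close>; appending it to \<open>t\<close> gives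
    \<open>\<mu>\<^sub>\<alpha>\<close>, the trail type that \<open>\<kappa>\<close>
    expects.\<close>
  note trails = has_type_trail_append[OF T_Control.hyps(3)]
    has_type_trail_cons[OF T_Control.hyps(2) trail.distinct(2), unfolded trail_trans.simps]
  show ?case unfolding interp.simps
    by (rule typing_rules IH T_Control.prems has_type_k_id[OF T_Control.hyps(1)] trails
        | (subst ty_trans.simps; rule HT_Lam))+
next
  case (T_Shift0 \<Gamma> k \<tau> \<tau>\<^sub>1 \<mu>\<^sub>1 \<sigma>\<^sub>1 \<tau>\<^sub>2 \<mu>\<^sub>2 \<sigma>\<^sub>2 \<alpha> D e \<tau>\<^sub>0 \<mu>\<^sub>0 \<sigma>\<^sub>0 \<tau>\<^sub>0' \<mu>\<^sub>0' \<sigma>\<^sub>0' \<beta> \<mu>\<^sub>\<beta>)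
  note prems = T_Shift0.prems[unfolded mcont_trans.simps]
  \<comment> \<open>The goal is unfolded too, so that both splits see product types.\<close>
  show ?case unfolding interp.simps mcont_trans.simps
    by (rule typing_rules T_Shift0.IH prems
        | (subst ty_trans.simps; rule HT_Lam))+
next
  case (T_Control0 \<tau>\<^sub>1 \<mu>\<^sub>1 \<sigma>\<^sub>1 \<tau>\<^sub>2 \<mu>\<^sub>2 \<mu>\<^sub>\<gamma> \<mu>\<^sub>\<beta> \<mu>\<^sub>\<alpha> \<Gamma> k \<tau> \<sigma>\<^sub>\<alpha> \<alpha> D e \<tau>\<^sub>0 \<mu>\<^sub>0 \<sigma>\<^sub>0 \<tau>\<^sub>0' \<mu>\<^sub>0' \<sigma>\<^sub>0' \<beta>)
  note trails = has_type_trail_append[OF T_Control0.hyps(2)]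
    has_type_trail_cons[OF T_Control0.hyps(1) trail.distinct(2), unfolded trail_trans.simps]
  show ?case unfolding interp.simps mcont_trans.simps
    by (rule typing_rules T_Control0.IH T_Control0.prems trails
        | (subst ty_trans.simps; rule HT_Lam))+
next
  case (T_Prompt \<gamma> \<mu>\<^sub>i\<^sub>d \<sigma>\<^sub>i\<^sub>d \<gamma>' \<Gamma> D e \<tau> \<mu>\<^sub>\<alpha> \<sigma>\<^sub>\<alpha> \<alpha> \<mu>\<^sub>\<beta> \<sigma>\<^sub>\<beta> \<beta>)
  note IH = T_Prompt.IH[unfolded trail_trans.simps mcont_trans.simps]
  show ?case unfolding interp.simps
    by (rule typing_rules IH T_Prompt.prems has_type_k_id[OF T_Prompt.hyps(1)])+
qed

theorem theorem4p2:
  fixes e :: expr and \<tau> :: ty and D :: deriv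
  assumes "Map.empty \<turnstile> D \<triangleright> e : \<tau> \<langle>\<bullet>\<^sub>\<mu>,\<bullet>\<^sub>\<sigma>\<rangle> \<tau> \<langle>\<bullet>\<^sub>\<mu>,\<bullet>\<^sub>\<sigma>\<rangle> \<tau>"
  shows "terminates (interp D Map.empty (k_id \<bullet>\<^sub>\<mu> \<bullet>\<^sub>\<sigma>) \<cdot> CUnit \<cdot> CUnit)"
proof (rule has_type_terminates)
  have "has_type [] (interp D Map.empty (k_id \<bullet>\<^sub>\<mu> \<bullet>\<^sub>\<sigma>)) (COne \<rightarrow>\<^sub>C COne \<rightarrow>\<^sub>C ty_trans \<tau>)"
    using has_type_interp[OF assms, of Map.empty "[]"] has_type_k_id[of \<tau> "\<bullet>\<^sub>\<mu>" "\<bullet>\<^sub>\<sigma>" \<tau>]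
    by (simp add: env_typed_def)
  then show "has_type [] (interp D Map.empty (k_id \<bullet>\<^sub>\<mu> \<bullet>\<^sub>\<sigma>) \<cdot> CUnit \<cdot> CUnit) (ty_trans \<tau>)"
    by (blast intro: has_type.intros)
qed

end
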